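(* Let $0<\theta<\pi$ and $S_\theta=\{z\in\mathbb{C}\setminus\{0\} : 0<\arg(z)<\theta\}$. For all $x,y\in S_\theta$ such that $\arg(x)\leq\arg(y)$ and $|x|=|y|=r>0$, the supremum $\sup_{a,b\in\partial S_\theta}|a,x,b,y|$ is given by the points $a=r$ and $b=re^{\theta i}$, that is, $$\sup_{a,b\in\partial S_\theta}|a,x,b,y|=|r,x,re^{\theta i},y|.$$
   Context: $\arg(z)\in[0,2\pi)$ is the principal argument of $z\in\mathbb{C}\setminus\{0\}$. Chordal metric on $\overline{\mathbb{C}}=\mathbb{C}\cup\{\infty\}$: $q(x,y)=\frac{|x-y|}{\sqrt{1+|x|^2}\sqrt{1+|y|^2}}$ for $x\ne\infty\ne y$ and $q(x,\infty)=\frac{1}{\sqrt{1+|x|^2}}$. Cross-ratio: $|a,b,c,d|=\frac{q(a,c)q(b,d)}{q(a,b)q(c,d)}$ (equal to $\frac{|a-c||b-d|}{|a-b||c-d|}$ for finite points; it is $0$ when $a=c$ or $b=d$). The boundary $\partial S_\theta$ is taken in $\overline{\mathbb{C}}$ (so $\infty\in\partial S_\theta$). *)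

theory Defs
  imports "HOL-Analysis.Analysis"
begin

text \<open>
  The extended complex plane is the one-point compactification of the complex plane; its carrier
  is \<^typ>\<open>complex option\<close>, and \<^term>\<open>None\<close> is the point at infinity.
\<close>

definition riemann_sphere :: "complex option topology" where
  "riemann_sphere = Alexandroff_compactification euclidean"

fun chordal :: "complex option \<Rightarrow> complex option \<Rightarrow> real" where
  "chordal (Some x) (Some y) =
     cmod (x - y) / (sqrt (1 + (cmod x)\<^sup>2) * sqrt (1 + (cmod y)\<^sup>2))"
| "chordal (Some x) None = 1 / sqrt (1 + (cmod x)\<^sup>2)"
| "chordal None (Some y) = 1 / sqrt (1 + (cmod y)\<^sup>2)"
| "chordal None None = 0"

text \<open>
  If \<open>a = b\<close> or \<open>c = d\<close>, where the cross-ratio is not defined, the value here is 0, since division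
  by zero yields zero.
\<close>

definition cross_ratio ::
  "complex option \<Rightarrow> complex option \<Rightarrow> complex option \<Rightarrow> complex option \<Rightarrow> real" where
  "cross_ratio a b c d = (chordal a c * chordal b d) / (chordal a b * chordal c d)"

definition sector :: "real \<Rightarrow> complex set" where
  "sector \<theta> = {z. z \<noteq> 0 \<and> 0 < Arg2pi z \<and> Arg2pi z < \<theta>}"

definition sector_boundary :: "real \<Rightarrow> complex option set" where
  "sector_boundary \<theta> = riemann_sphere frontier_of (Some ` sector \<theta>)"

end

theory Submission
  imports Defs
begin

text \<open>
  The cross-ratio is \<open>|a - b| |x - y| / (|a - x| |b - y|)\<close>. Put \<open>x = r cis \<alpha>\<close>, \<open>y = r cis \<beta>\<close>,
  \<open>A = sin (\<alpha>/2)\<close>, \<open>G = sin ((\<theta> - \<beta>)/2)\<close>, \<open>T = sin (\<theta>/2)\<close>. For a boundary point at distance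
  \<open>r t\<close> from the origin, the squared distances to \<open>x\<close> and \<open>y\<close> have the form
  \<open>r\<^sup>2 ((t - 1)\<^sup>2 + 4 t B\<^sup>2)\<close>, where \<open>B \<ge> A\<close> on the positive real ray and \<open>B \<ge> G\<close> on the other ray,
  so the claim becomes polynomial in the two positions. When \<open>a\<close> and \<open>b\<close> lie on different rays,
  the worst case for fixed \<open>\<alpha>\<close> and \<open>\<gamma> = \<theta> - \<beta>\<close> is \<open>\<theta> = \<alpha> + \<gamma>\<close>, and there the inequality is a sum
  of squares with nonnegative coefficients because \<open>cos ((\<alpha> + \<gamma>)/2) \<ge> 0\<close>.
\<close>

section \<open>Trigonometric inequalities for two positions on the bounding rays\<close>

text \<open>The extremal case of \<open>opposite_rays_bound\<close>: for sines \<open>A\<close>,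
  \<open>G\<close> and cosines \<open>C\<close>, \<open>D\<close> of \<alpha>/2 and \<gamma>/2,
  \<open>A * D + C * G\<close> is the sine of (\<alpha> + \<gamma>)/2, and \<open>K\<close> says
  that its cosine is nonnegative.\<close>

lemma half_angle_product_bound:
  fixes A C G D t s :: real
  assumes nn: "0 \<le> A" "0 \<le> C" "0 \<le> G" "0 \<le> D"
    and AC: "A\<^sup>2 + C\<^sup>2 = 1" and GD: "G\<^sup>2 + D\<^sup>2 = 1"
    and K: "A * G \<le> C * D"
  shows "4 * ((t - s)\<^sup>2 + 4 * t * s * (A * D + C * G)\<^sup>2) * A\<^sup>2 * G\<^sup>2
    \<le> (A * D + C * G)\<^sup>2 * ((t - 1)\<^sup>2 + 4 * t * A\<^sup>2) * ((s - 1)\<^sup>2 + 4 * s * G\<^sup>2)"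
proof -
  define T where "T = A * D + C * G"
  define k where "k = C * D - A * G"
  define m where "m = t - 1"
  define n where "n = s - 1"
  have k0: "0 \<le> k" using K by (simp add: k_def)
  have C2: "C\<^sup>2 = 1 - A\<^sup>2" and D2: "D\<^sup>2 = 1 - G\<^sup>2" using AC GD by auto
  have Tk: "T\<^sup>2 + k\<^sup>2 = 1"
    unfolding T_def k_def using AC GD by algebra
  \<comment> \<open>Subtraction formulas: with u = \<alpha>/2 and v = \<gamma>/2, expand sin u = sin
    ((u + v) - v), and symmetrically for v. They make the differences in \<open>1\<close> multiples
    of \<open>k\<close>.\<close>
  have TD: "T * D = A + G * k"
    unfolding T_def k_def using AC GD by algebra
  have TC: "T * C = G + A * k"
    unfolding T_def k_def using AC GD by algebra
  have 1: "(T * D)\<^sup>2 - A\<^sup>2 = G * k * (2 * A + G * k)" "(T * C)\<^sup>2 - G\<^sup>2 = A * k * (2 * G + A * k)"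
    unfolding TD TC by algebra+
  \<comment> \<open>A square is split off; what remains is a quadratic form in \<open>m\<close> and
    \<open>n\<close>. Its coefficients carry the factor \<open>k\<close>, and regrouping them below
    gives another square plus nonnegative terms.\<close>
  have id: "T\<^sup>2 * (m\<^sup>2 + 4 * t * A\<^sup>2) * (n\<^sup>2 + 4 * s * G\<^sup>2) - 4 * ((t - s)\<^sup>2 + 4 * t * s * T\<^sup>2) * A\<^sup>2 * G\<^sup>2
    = T\<^sup>2 * (m * n + 2 * G\<^sup>2 * m + 2 * A\<^sup>2 * n)\<^sup>2
      + 4 * (m\<^sup>2 * G\<^sup>2 * ((T * D)\<^sup>2 - A\<^sup>2) + n\<^sup>2 * A\<^sup>2 * ((T * C)\<^sup>2 - G\<^sup>2) + 2 * m * n * A\<^sup>2 * G\<^sup>2 * (1 - T\<^sup>2))"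
    unfolding power_mult_distrib C2 D2 m_def n_def by algebra
  have "m\<^sup>2 * G\<^sup>2 * ((T * D)\<^sup>2 - A\<^sup>2) + n\<^sup>2 * A\<^sup>2 * ((T * C)\<^sup>2 - G\<^sup>2) + 2 * m * n * A\<^sup>2 * G\<^sup>2 * (1 - T\<^sup>2)
     = m\<^sup>2 * G\<^sup>2 * (G * k * (2 * A + G * k)) + n\<^sup>2 * A\<^sup>2 * (A * k * (2 * G + A * k)) + 2 * m * n * A\<^sup>2 * G\<^sup>2 * k\<^sup>2"
    unfolding 1 using Tk by algebra
  also have "\<dots> = k\<^sup>2 * ((m * G\<^sup>2)\<^sup>2 + (n * A\<^sup>2)\<^sup>2 + 2 * (m * G\<^sup>2) * (n * A\<^sup>2)) + 2 * k * A * G * ((m * G)\<^sup>2 + (n * A)\<^sup>2)"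
    by algebra
  also have "\<dots> = (k * (m * G\<^sup>2 + n * A\<^sup>2))\<^sup>2 + 2 * k * A * G * ((m * G)\<^sup>2 + (n * A)\<^sup>2)"
    by algebra
  also have "\<dots> \<ge> 0" using k0 nn by simp
  finally have "0 \<le> T\<^sup>2 * (m\<^sup>2 + 4 * t * A\<^sup>2) * (n\<^sup>2 + 4 * s * G\<^sup>2) - 4 * ((t - s)\<^sup>2 + 4 * t * s * T\<^sup>2) * A\<^sup>2 * G\<^sup>2"
    unfolding id by simp
  then show ?thesis unfolding T_def m_def n_def by simp
qed

text \<open>Expanding sin ((\<theta> - \<alpha>)/2) leaves a nonnegative term to drop. This estimate
  serves the cases of two points on one ray and of a point at infinity.\<close>

lemma sin_half_le_mult_cos_half:
  fixes \<alpha> \<gamma> \<theta> :: real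
  assumes "0 \<le> \<alpha>" "0 \<le> \<gamma>" "\<alpha> + \<gamma> \<le> \<theta>" "\<theta> \<le> pi"
  shows "sin (\<gamma> / 2) \<le> sin (\<theta> / 2) * cos (\<alpha> / 2)"
proof -
  have "sin (\<gamma> / 2) \<le> sin ((\<theta> - \<alpha>) / 2)"
    using assms by (intro sin_monotone_2pi_le) auto
  also have "\<dots> = sin (\<theta> / 2) * cos (\<alpha> / 2) - cos (\<theta> / 2) * sin (\<alpha> / 2)"
    by (simp add: diff_divide_distrib sin_diff)
  also have "\<dots> \<le> sin (\<theta> / 2) * cos (\<alpha> / 2)"
    using assms by (auto intro!: mult_nonneg_nonneg cos_ge_zero sin_ge_zero)
  finally show ?thesis .
qed

lemma opposite_rays_bound:
  fixes \<alpha> \<gamma> \<theta> t s :: real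
  assumes "0 \<le> \<alpha>" "0 \<le> \<gamma>" "\<alpha> + \<gamma> \<le> \<theta>" "\<theta> \<le> pi" "0 \<le> t" "0 \<le> s"
  shows "4 * ((t - s)\<^sup>2 + 4 * t * s * (sin (\<theta> / 2))\<^sup>2) * (sin (\<alpha> / 2))\<^sup>2 * (sin (\<gamma> / 2))\<^sup>2
    \<le> (sin (\<theta> / 2))\<^sup>2 * ((t - 1)\<^sup>2 + 4 * t * (sin (\<alpha> / 2))\<^sup>2) * ((s - 1)\<^sup>2 + 4 * s * (sin (\<gamma> / 2))\<^sup>2)"
proof -
  define A C G D T where defs: "A = sin (\<alpha> / 2)" "C = cos (\<alpha> / 2)" "G = sin (\<gamma> / 2)" "D = cos (\<gamma> / 2)" "T = sin (\<theta> / 2)"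
  define T' where "T' = A * D + C * G"
  \<comment> \<open>\<open>Q\<close> is the coefficient of the squared sine of \<theta>/2 in right
    side minus left side. It is nonnegative, so the difference only shrinks when \<theta> is lowered
    to \<alpha> + \<gamma>.\<close>
  define Q where "Q = ((t - 1)\<^sup>2 + 4 * t * A\<^sup>2) * ((s - 1)\<^sup>2 + 4 * s * G\<^sup>2) - (4 * t * A\<^sup>2) * (4 * s * G\<^sup>2)"
  have T': "T' = sin ((\<alpha> + \<gamma>) / 2)"
    by (simp add: T'_def defs sin_add add_divide_distrib)
  have "0 \<le> cos ((\<alpha> + \<gamma>) / 2)"
    using assms by (intro cos_ge_zero) auto
  then have K: "A * G \<le> C * D"
    by (simp add: defs cos_add add_divide_distrib)
  have nn: "0 \<le> A" "0 \<le> C" "0 \<le> G" "0 \<le> D"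
    unfolding defs using assms by (auto intro!: cos_ge_zero sin_ge_zero)
  have "0 \<le> T'" "T' \<le> T"
    unfolding T' defs using assms by (auto intro!: sin_ge_zero sin_monotone_2pi_le)
  then have TT: "T'\<^sup>2 \<le> T\<^sup>2"
    by simp
  have "0 \<le> Q"
    unfolding Q_def diff_ge_0_iff_ge using assms by (intro mult_mono) auto
  with TT have "T'\<^sup>2 * Q \<le> T\<^sup>2 * Q"
    by (rule mult_right_mono)
  moreover have "4 * ((t - s)\<^sup>2 + 4 * t * s * T'\<^sup>2) * A\<^sup>2 * G\<^sup>2
    \<le> T'\<^sup>2 * ((t - 1)\<^sup>2 + 4 * t * A\<^sup>2) * ((s - 1)\<^sup>2 + 4 * s * G\<^sup>2)"
    unfolding T'_def using nn K by (intro half_angle_product_bound) (simp_all add: defs)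
  ultimately show ?thesis
    unfolding Q_def defs[symmetric] by (simp add: algebra_simps)
qed

text \<open>The right side is the squared distance from \<open>t\<close> to
  \<open>cis \<alpha>\<close>. The distance of \<open>cis \<alpha>\<close> from the real line is
  |sin \<alpha>|, reached at t = cos \<alpha>.\<close>

lemma ray_dist_lower_bound:
  "4 * (sin (\<alpha> / 2))\<^sup>2 * (cos (\<alpha> / 2))\<^sup>2 \<le> (t - 1)\<^sup>2 + 4 * t * (sin (\<alpha> / 2))\<^sup>2" for \<alpha> t :: real
proof -
  have "(t - 1)\<^sup>2 + 4 * t * (sin (\<alpha> / 2))\<^sup>2 - 4 * (sin (\<alpha> / 2))\<^sup>2 * (cos (\<alpha> / 2))\<^sup>2
    = (t - 1 + 2 * (sin (\<alpha> / 2))\<^sup>2)\<^sup>2"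
    using sin_cos_squared_add[of "\<alpha> / 2"] by algebra
  then show ?thesis
    by (metis diff_ge_0_iff_ge zero_le_power2)
qed

text \<open>Formally, the two-point bounds divided by the square of \<open>s\<close>, as
  \<open>s\<close> tends to infinity.\<close>

lemma point_at_infinity_bound:
  fixes \<alpha> \<gamma> \<theta> t :: real
  assumes "0 \<le> \<alpha>" "0 \<le> \<gamma>" "\<alpha> + \<gamma> \<le> \<theta>" "\<theta> \<le> pi"
  shows "4 * (sin (\<alpha> / 2))\<^sup>2 * (sin (\<gamma> / 2))\<^sup>2
    \<le> (sin (\<theta> / 2))\<^sup>2 * ((t - 1)\<^sup>2 + 4 * t * (sin (\<alpha> / 2))\<^sup>2)"
proof -
  have "(sin (\<gamma> / 2))\<^sup>2 \<le> (sin (\<theta> / 2) * cos (\<alpha> / 2))\<^sup>2"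
    using assms by (intro power_mono sin_half_le_mult_cos_half sin_ge_zero) auto
  then have "4 * (sin (\<alpha> / 2))\<^sup>2 * (sin (\<gamma> / 2))\<^sup>2 \<le> 4 * (sin (\<alpha> / 2))\<^sup>2 * (sin (\<theta> / 2) * cos (\<alpha> / 2))\<^sup>2"
    by (intro mult_left_mono) auto
  also have "\<dots> = (sin (\<theta> / 2))\<^sup>2 * (4 * (sin (\<alpha> / 2))\<^sup>2 * (cos (\<alpha> / 2))\<^sup>2)"
    by (simp add: power_mult_distrib)
  also have "\<dots> \<le> (sin (\<theta> / 2))\<^sup>2 * ((t - 1)\<^sup>2 + 4 * t * (sin (\<alpha> / 2))\<^sup>2)"
    by (intro mult_left_mono ray_dist_lower_bound) simp
  finally show ?thesis .
qed

text \<open>Twice the area of the triangle with vertices \<open>t\<close>, \<open>s\<close>,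
  \<open>cis \<alpha>\<close> is |t - s| |sin \<alpha>|, which is at most the product of the two
  sides meeting at \<open>cis \<alpha>\<close>. The square in the proof is that of the scalar
  product of these sides.\<close>

lemma same_ray_bound:
  fixes \<alpha> \<gamma> \<theta> t s :: real
  assumes "0 \<le> \<alpha>" "0 \<le> \<gamma>" "\<alpha> + \<gamma> \<le> \<theta>" "\<theta> \<le> pi"
  shows "4 * (t - s)\<^sup>2 * (sin (\<alpha> / 2))\<^sup>2 * (sin (\<gamma> / 2))\<^sup>2
    \<le> (sin (\<theta> / 2))\<^sup>2 * ((t - 1)\<^sup>2 + 4 * t * (sin (\<alpha> / 2))\<^sup>2) * ((s - 1)\<^sup>2 + 4 * s * (sin (\<alpha> / 2))\<^sup>2)"
proof -
  define A C G T where defs: "A = sin (\<alpha> / 2)" "C = cos (\<alpha> / 2)" "G = sin (\<gamma> / 2)" "T = sin (\<theta> / 2)"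
  have AC: "A\<^sup>2 + C\<^sup>2 = 1"
    by (simp add: defs)
  have "((t - 1)\<^sup>2 + 4 * t * A\<^sup>2) * ((s - 1)\<^sup>2 + 4 * s * A\<^sup>2) - 4 * A\<^sup>2 * C\<^sup>2 * (t - s)\<^sup>2
    = (t * s - (1 - 2 * A\<^sup>2) * (t + s) + 1)\<^sup>2"
    using AC by algebra
  then have P: "4 * A\<^sup>2 * C\<^sup>2 * (t - s)\<^sup>2 \<le> ((t - 1)\<^sup>2 + 4 * t * A\<^sup>2) * ((s - 1)\<^sup>2 + 4 * s * A\<^sup>2)"
    by (metis diff_ge_0_iff_ge zero_le_power2)
  have "G\<^sup>2 \<le> (T * C)\<^sup>2"
    unfolding defs using assms by (intro power_mono sin_half_le_mult_cos_half sin_ge_zero) auto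
  then have "4 * (t - s)\<^sup>2 * A\<^sup>2 * G\<^sup>2 \<le> 4 * (t - s)\<^sup>2 * A\<^sup>2 * (T * C)\<^sup>2"
    by (intro mult_left_mono) auto
  also have "\<dots> = T\<^sup>2 * (4 * A\<^sup>2 * C\<^sup>2 * (t - s)\<^sup>2)"
    by (simp add: power_mult_distrib)
  also have "\<dots> \<le> T\<^sup>2 * (((t - 1)\<^sup>2 + 4 * t * A\<^sup>2) * ((s - 1)\<^sup>2 + 4 * s * A\<^sup>2))"
    by (intro mult_left_mono P) simp
  finally show ?thesis
    unfolding defs by (simp add: mult.assoc)
qed

section \<open>Polar coordinates, the sector and its boundary\<close>

text \<open>The law of cosines in half-angle form; p = r t and q = r give the distances to
  \<open>x\<close> and \<open>y\<close>.\<close>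

lemma norm_polar_diff_sq:
  "(cmod (of_real p * cis \<phi> - of_real q * cis \<psi>))\<^sup>2 = (p - q)\<^sup>2 + 4 * p * q * (sin ((\<phi> - \<psi>) / 2))\<^sup>2"
proof -
  have "cos (\<phi> - \<psi>) = 1 - 2 * (sin ((\<phi> - \<psi>) / 2))\<^sup>2"
    using cos_double_sin[of "(\<phi> - \<psi>) / 2"] by (simp only: mult_2 field_sum_of_halves)
  then have "cos \<phi> * cos \<psi> + sin \<phi> * sin \<psi> = 1 - 2 * (sin ((\<phi> - \<psi>) / 2))\<^sup>2"
    by (simp add: cos_diff)
  moreover have "(cmod (of_real p * cis \<phi> - of_real q * cis \<psi>))\<^sup>2
      = (p * cos \<phi> - q * cos \<psi>)\<^sup>2 + (p * sin \<phi> - q * sin \<psi>)\<^sup>2"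
    by (simp add: cmod_power2)
  ultimately show ?thesis
    using sin_cos_squared_add[of \<phi>] sin_cos_squared_add[of \<psi>] by algebra
qed

lemma polar_Arg2pi: "of_real (cmod z) * cis (Arg2pi z) = z"
  by (metis Arg2pi_eq cis_conv_exp mult.commute)

text \<open>For \<theta> < pi the sector is an intersection of two open half-planes; multiplying by
  \<open>cis (- \<theta>)\<close> turns the upper ray onto the positive real axis. Openness and
  closure then follow from continuity of \<open>Im\<close>.\<close>

lemma sector_iff:
  assumes "0 < \<theta>" "\<theta> < pi"
  shows "z \<in> sector \<theta> \<longleftrightarrow> 0 < Im z \<and> Im (z * cis (- \<theta>)) < 0"
proof (cases "z = 0")
  case False
  define \<phi> where "\<phi> = Arg2pi z"
  have \<phi>: "0 \<le> \<phi>" "\<phi> < 2 * pi"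
    by (auto simp: \<phi>_def Arg2pi_ge_0 Arg2pi_lt_2pi)
  have z: "z = of_real (cmod z) * cis \<phi>"
    by (simp add: \<phi>_def polar_Arg2pi)
  have "Im z = cmod z * sin \<phi>"
    by (subst z) simp
  then have 1: "0 < Im z \<longleftrightarrow> 0 < sin \<phi>"
    using False by (simp add: zero_less_mult_iff)
  have "z * cis (- \<theta>) = of_real (cmod z) * cis (\<phi> - \<theta>)"
    by (subst z) (simp add: mult.assoc cis_mult)
  then have "Im (z * cis (- \<theta>)) = cmod z * sin (\<phi> - \<theta>)"
    by simp
  then have 2: "Im (z * cis (- \<theta>)) < 0 \<longleftrightarrow> sin (\<phi> - \<theta>) < 0"
    using False by (simp add: mult_less_0_iff)
  have "0 < \<phi> \<and> \<phi> < \<theta> \<longleftrightarrow> 0 < sin \<phi> \<and> sin (\<phi> - \<theta>) < 0"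
  proof
    assume "0 < \<phi> \<and> \<phi> < \<theta>"
    then show "0 < sin \<phi> \<and> sin (\<phi> - \<theta>) < 0"
      using assms sin_gt_zero[of \<phi>] sin_gt_zero[of "\<theta> - \<phi>"] sin_minus[of "\<theta> - \<phi>"] by auto
  next
    assume *: "0 < sin \<phi> \<and> sin (\<phi> - \<theta>) < 0"
    then have "\<phi> \<noteq> 0" by auto
    moreover have "\<phi> < pi"
      using * \<phi> sin_le_zero[of \<phi>] by force
    moreover have "\<phi> < \<theta>"
      using * assms \<open>\<phi> < pi\<close> sin_ge_zero[of "\<phi> - \<theta>"] by force
    ultimately show "0 < \<phi> \<and> \<phi> < \<theta>"
      using \<phi> by simp
  qed
  then show ?thesis
    using False 1 2 by (simp add: sector_def \<phi>_def)
qed (simp add: sector_def)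

text \<open>\<open>Some\<close> is an open embedding into the compactification, so closure and
  interior at finite points are those of the plane.\<close>

lemma sector_boundary_Some:
  "Some z \<in> sector_boundary \<theta> \<longleftrightarrow> z \<in> frontier (sector \<theta>)"
proof -
  have open_iff: "openin riemann_sphere U \<Longrightarrow> open (Some -` U)" for U
    using openin_continuous_map_preimage[OF continuous_map_Some[of euclidean], of U]
    by (simp add: riemann_sphere_def vimage_def)
  have img: "open V \<Longrightarrow> openin riemann_sphere (Some ` V)" for V :: "complex set"
    by (simp add: riemann_sphere_def)
  have "Some z \<in> riemann_sphere closure_of (Some ` S) \<longleftrightarrow> z \<in> closure S" for S
  proof
    assume "Some z \<in> riemann_sphere closure_of (Some ` S)"
    then show "z \<in> closure S"
      unfolding in_closure_of closure_iff_nhds_not_empty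
      using img by (smt (verit) disjoint_iff imageE image_eqI option.inject subsetD)
  next
    assume z: "z \<in> closure S"
    have "\<exists>y. y \<in> Some ` S \<and> y \<in> U" if "Some z \<in> U" "openin riemann_sphere U" for U
      using z open_iff[OF that(2)] that(1) unfolding closure_iff_nhds_not_empty
      by (metis disjoint_iff imageI order_refl vimage_eq)
    then show "Some z \<in> riemann_sphere closure_of (Some ` S)"
      by (auto simp: in_closure_of riemann_sphere_def)
  qed
  moreover have "Some z \<in> riemann_sphere interior_of (Some ` S) \<longleftrightarrow> z \<in> interior S" for S
  proof
    assume "Some z \<in> riemann_sphere interior_of (Some ` S)"
    then obtain U where U: "openin riemann_sphere U" "Some z \<in> U" "U \<subseteq> Some ` S"
      by (auto simp: interior_of_def)
    then show "z \<in> interior S"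
      using open_iff[OF U(1)] by (intro interiorI[of "Some -` U"]) auto
  next
    assume "z \<in> interior S"
    then show "Some z \<in> riemann_sphere interior_of (Some ` S)"
      unfolding interior_of_def interior_def using img by blast
  qed
  ultimately show ?thesis
    by (simp add: sector_boundary_def frontier_of_def frontier_def)
qed

lemma frontier_sector:
  assumes "0 < \<theta>" "\<theta> < pi"
  shows "frontier (sector \<theta>) = (\<lambda>t. of_real t) ` {0..} \<union> (\<lambda>t. of_real t * cis \<theta>) ` {0..}"
proof -
  have s: "0 < sin \<theta>"
    using assms by (simp add: sin_gt_zero)
  have S: "sector \<theta> = {z. 0 < Im z} \<inter> {z. Im (z * cis (- \<theta>)) < 0}"
    using sector_iff[OF assms] by auto
  have "open (sector \<theta>)"
    unfolding S by (intro open_Int open_Collect_less continuous_intros)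
  then have fr: "frontier (sector \<theta>) = closure (sector \<theta>) - sector \<theta>"
    by (simp add: frontier_def interior_open)
  have cl: "closure (sector \<theta>) = {z. 0 \<le> Im z} \<inter> {z. Im (z * cis (- \<theta>)) \<le> 0}" (is "_ = ?R")
  proof
    have "closed ?R"
      by (intro closed_Int closed_Collect_le continuous_intros)
    then show "closure (sector \<theta>) \<subseteq> ?R"
      unfolding S by (intro closure_minimal) auto
  next
    show "?R \<subseteq> closure (sector \<theta>)"
    proof
      fix z assume z: "z \<in> ?R"
      have Im_scale: "Im (of_real k * u) = k * Im u" for k u
        by simp
      \<comment> \<open>\<open>w\<close> points along the bisector, where both half-plane
        inequalities are strict. Adding small positive multiples of it moves any point of
        \<open>?R\<close> into the sector.\<close>
      define w where "w = cis (\<theta> / 2)"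
      have "0 < sin (\<theta> / 2)"
        using assms by (intro sin_gt_zero) auto
      moreover have "w * cis (- \<theta>) = cis (- (\<theta> / 2))"
        by (simp add: w_def cis_mult)
      ultimately have w: "0 < Im w" "Im (w * cis (- \<theta>)) < 0"
        by (simp_all add: w_def)
      have mem: "z + of_real (inverse (real (Suc n))) * w \<in> sector \<theta>" for n
      proof -
        let ?e = "inverse (real (Suc n))"
        have "(z + of_real ?e * w) * cis (- \<theta>) = z * cis (- \<theta>) + of_real ?e * (w * cis (- \<theta>))"
          by (simp only: distrib_right mult.assoc)
        then have "Im ((z + of_real ?e * w) * cis (- \<theta>)) = Im (z * cis (- \<theta>)) + ?e * Im (w * cis (- \<theta>))"
          by (simp only: plus_complex.sel Im_scale)
        moreover have "?e * Im (w * cis (- \<theta>)) < 0" "0 < ?e * Im w"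
          using w by (simp_all add: mult_less_0_iff zero_less_mult_iff)
        moreover have "Im (z + of_real ?e * w) = Im z + ?e * Im w"
          by (simp only: plus_complex.sel Im_scale)
        ultimately show ?thesis
          using z unfolding S by auto
      qed
      have "(\<lambda>n. z + of_real (inverse (real (Suc n))) * w) \<longlonglongrightarrow> z + of_real 0 * w"
        by (intro tendsto_intros LIMSEQ_inverse_real_of_nat)
      then show "z \<in> closure (sector \<theta>)"
        unfolding closure_sequential using mem by (intro exI conjI allI) auto
    qed
  qed
  have inR: "of_real t \<in> closure (sector \<theta>) - sector \<theta>" "of_real t * cis \<theta> \<in> closure (sector \<theta>) - sector \<theta>"
    if "0 \<le> t" for t
    unfolding cl unfolding S using that s by (auto simp: mult.assoc cis_mult)
  have "z \<in> (\<lambda>t. of_real t) ` {0..} \<union> (\<lambda>t. of_real t * cis \<theta>) ` {0..}"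
    if "z \<in> closure (sector \<theta>) - sector \<theta>" for z
  proof -
    from that consider "Im z = 0" "Im (z * cis (- \<theta>)) \<le> 0" | "0 \<le> Im z" "Im (z * cis (- \<theta>)) = 0"
      unfolding cl unfolding S by fastforce
    then show ?thesis
    proof cases
      case 1
      then have "0 \<le> Re z" "z = of_real (Re z)"
        using s by (auto simp: complex_eq_iff zero_le_mult_iff)
      then show ?thesis by blast
    next
      case 2
      define t where "t = Re (z * cis (- \<theta>))"
      have "z * cis (- \<theta>) = of_real t"
        using 2 by (simp add: t_def complex_eq_iff)
      then have "z * cis (- \<theta>) * cis \<theta> = of_real t * cis \<theta>"
        by simp
      then have z: "z = of_real t * cis \<theta>"
        by (simp add: mult.assoc cis_mult)
      with 2 s have "0 \<le> t"
        by (simp add: zero_le_mult_iff)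
      with z show ?thesis by blast
    qed
  qed
  with inR fr show ?thesis by blast
qed

section \<open>The bound for all finite boundary points\<close>

text \<open>The constant \<open>K\<close> makes the first bound an equality for a = r, b = r cis
  \<theta>, z = r cis \<alpha>, w = r cis \<beta>. The second bound covers a point at infinity.
  Leaving \<open>z\<close> and \<open>w\<close> free between the angles \<alpha> and \<beta> lets it
  be applied to \<open>x\<close> or to \<open>y\<close>.\<close>

lemma sector_frontier_product_bound:
  fixes r \<alpha> \<beta> \<theta> :: real and z w a b :: complex
  assumes r: "0 < r" and ang: "0 < \<alpha>" "\<alpha> \<le> \<beta>" "\<beta> < \<theta>" "\<theta> < pi"
    and z: "z = of_real r * cis \<phi>" "\<alpha> \<le> \<phi>" "\<phi> \<le> \<beta>"
    and w: "w = of_real r * cis \<psi>" "\<alpha> \<le> \<psi>" "\<psi> \<le> \<beta>"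
    and a: "a \<in> frontier (sector \<theta>)" and b: "b \<in> frontier (sector \<theta>)"
  defines "K \<equiv> 2 * r * sin (\<alpha> / 2) * sin ((\<theta> - \<beta>) / 2)"
  shows "cmod (a - b) * K \<le> sin (\<theta> / 2) * (cmod (a - z) * cmod (b - w))"
    and "K \<le> sin (\<theta> / 2) * cmod (a - z)"
proof -
  define A G T where defs: "A = sin (\<alpha> / 2)" "G = sin ((\<theta> - \<beta>) / 2)" "T = sin (\<theta> / 2)"
  have pos: "0 \<le> A" "0 \<le> G" "0 \<le> T"
    unfolding defs using ang by (auto intro!: sin_ge_zero)
  have sub: "0 \<le> \<alpha>" "0 \<le> \<theta> - \<beta>" "\<alpha> + (\<theta> - \<beta>) \<le> \<theta>" "\<theta> - \<beta> + \<alpha> \<le> \<theta>" "\<theta> \<le> pi"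
    using ang by auto
  define P where "P = (\<lambda>B t. (t - 1)\<^sup>2 + 4 * t * B\<^sup>2 :: real)"
  have P0: "0 \<le> P B t" if "0 \<le> t" for B t
    using that by (simp add: P_def)
  \<comment> \<open>The lower bound depends on the ray only: all half-angles lie in [0, pi/2], where
    the sine increases, so \<open>A\<close> serves the real ray and \<open>G\<close> the other ray
    for every \<phi> between \<alpha> and \<beta>.\<close>
  have near: "r\<^sup>2 * P A t \<le> (cmod (of_real (r * t) * cis 0 - of_real r * cis \<phi>))\<^sup>2"
    "r\<^sup>2 * P G t \<le> (cmod (of_real (r * t) * cis \<theta> - of_real r * cis \<phi>))\<^sup>2"
    if "0 \<le> t" "\<alpha> \<le> \<phi>" "\<phi> \<le> \<beta>" for t \<phi>
  proof -
    have eq: "(cmod (of_real (r * t) * cis \<omega> - of_real r * cis \<phi>))\<^sup>2 = r\<^sup>2 * P (sin ((\<omega> - \<phi>) / 2)) t" for \<omega>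
      unfolding norm_polar_diff_sq P_def by algebra
    have "A \<le> sin (\<phi> / 2)" "G \<le> sin ((\<theta> - \<phi>) / 2)"
      unfolding defs using that ang by (auto intro!: sin_monotone_2pi_le)
    then have "A\<^sup>2 \<le> (sin ((0 - \<phi>) / 2))\<^sup>2" "G\<^sup>2 \<le> (sin ((\<theta> - \<phi>) / 2))\<^sup>2"
      using pos by (auto intro!: power_mono)
    then show "r\<^sup>2 * P A t \<le> (cmod (of_real (r * t) * cis 0 - of_real r * cis \<phi>))\<^sup>2"
      "r\<^sup>2 * P G t \<le> (cmod (of_real (r * t) * cis \<theta> - of_real r * cis \<phi>))\<^sup>2"
      unfolding eq P_def using r that by (auto intro!: mult_left_mono)
  qed
  have repr: "\<exists>t\<ge>0. c = of_real (r * t) * cis 0 \<or> c = of_real (r * t) * cis \<theta>"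
    if c: "c \<in> frontier (sector \<theta>)" for c
  proof -
    obtain p where "0 \<le> p" "c = of_real p * cis 0 \<or> c = of_real p * cis \<theta>"
      using c ang frontier_sector[of \<theta>] by auto
    then show ?thesis
      using r by (intro exI[of _ "p / r"]) auto
  qed
  obtain t where t: "0 \<le> t" "a = of_real (r * t) * cis 0 \<or> a = of_real (r * t) * cis \<theta>"
    using repr[OF a] by blast
  obtain s where s: "0 \<le> s" "b = of_real (r * s) * cis 0 \<or> b = of_real (r * s) * cis \<theta>"
    using repr[OF b] by blast
  have K: "K = r * (2 * A * G)"
    by (simp add: K_def defs)

  obtain B where B: "B = A \<or> B = G" "r\<^sup>2 * P B t \<le> (cmod (a - z))\<^sup>2"
    using t near[of t \<phi>] z by blast
  have "4 * A\<^sup>2 * G\<^sup>2 \<le> T\<^sup>2 * P B t"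
    using B(1) point_at_infinity_bound[of \<alpha> "\<theta> - \<beta>" \<theta> t] point_at_infinity_bound[of "\<theta> - \<beta>" \<alpha> \<theta> t] sub
    unfolding defs P_def by (auto simp: mult_ac)
  then have "r\<^sup>2 * (4 * A\<^sup>2 * G\<^sup>2) \<le> r\<^sup>2 * (T\<^sup>2 * P B t)"
    by (rule mult_left_mono) simp
  also have "\<dots> = T\<^sup>2 * (r\<^sup>2 * P B t)"
    by simp
  also have "\<dots> \<le> T\<^sup>2 * (cmod (a - z))\<^sup>2"
    using B by (intro mult_left_mono) auto
  finally have "K\<^sup>2 \<le> (T * cmod (a - z))\<^sup>2"
    by (simp add: K power_mult_distrib)
  then show "K \<le> sin (\<theta> / 2) * cmod (a - z)"
    unfolding defs(3)[symmetric] by (rule power2_le_imp_le) (use pos in simp)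

  \<comment> \<open>\<open>N\<close> is the squared distance of \<open>a\<close> and
    \<open>b\<close> in units of \<open>r\<close>; \<open>B\<close> and \<open>B'\<close> are
    \<open>A\<close> or \<open>G\<close> according to the rays of \<open>a\<close> and
    \<open>b\<close>. Squaring reduces the goal to the polynomial bounds.\<close>
  have combine: "cmod (a - b) * K \<le> sin (\<theta> / 2) * (cmod (a - z) * cmod (b - w))"
    if "(cmod (a - b))\<^sup>2 = r\<^sup>2 * N" "4 * N * A\<^sup>2 * G\<^sup>2 \<le> T\<^sup>2 * P B t * P B' s"
      "r\<^sup>2 * P B t \<le> (cmod (a - z))\<^sup>2" "r\<^sup>2 * P B' s \<le> (cmod (b - w))\<^sup>2" for N B B'
  proof -
    have "(cmod (a - b) * K)\<^sup>2 = r ^ 4 * (4 * N * A\<^sup>2 * G\<^sup>2)"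
      unfolding power_mult_distrib that(1) K by algebra
    also have "\<dots> \<le> r ^ 4 * (T\<^sup>2 * P B t * P B' s)"
      by (intro mult_left_mono that) simp
    also have "\<dots> = T\<^sup>2 * ((r\<^sup>2 * P B t) * (r\<^sup>2 * P B' s))"
      by algebra
    also have "\<dots> \<le> T\<^sup>2 * ((cmod (a - z))\<^sup>2 * (cmod (b - w))\<^sup>2)"
      using that s t P0 by (intro mult_left_mono mult_mono) auto
    also have "\<dots> = (T * (cmod (a - z) * cmod (b - w)))\<^sup>2"
      by (simp add: power_mult_distrib)
    finally show ?thesis
      unfolding defs(3)[symmetric] by (rule power2_le_imp_le) (use pos in simp)
  qed
  have d: "(cmod (of_real (r * t) * cis \<omega> - of_real (r * s) * cis \<omega>'))\<^sup>2
      = r\<^sup>2 * ((t - s)\<^sup>2 + 4 * t * s * (sin ((\<omega> - \<omega>') / 2))\<^sup>2)" for \<omega> \<omega>'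
    unfolding norm_polar_diff_sq by algebra
  note nz = near[OF t(1) z(2,3), folded z(1)] and nw = near[OF s(1) w(2,3), folded w(1)]
  from t(2) s(2) show "cmod (a - b) * K \<le> sin (\<theta> / 2) * (cmod (a - z) * cmod (b - w))"
  proof (elim disjE)
    assume ab: "a = of_real (r * t) * cis 0" "b = of_real (r * s) * cis 0"
    have "4 * (t - s)\<^sup>2 * A\<^sup>2 * G\<^sup>2 \<le> T\<^sup>2 * P A t * P A s"
      unfolding defs P_def using sub by (intro same_ray_bound)
    moreover have "(cmod (a - b))\<^sup>2 = r\<^sup>2 * (t - s)\<^sup>2"
      unfolding ab d by simp
    ultimately show ?thesis
      using nz(1) nw(1) unfolding ab[symmetric] by (intro combine)
  next
    assume ab: "a = of_real (r * t) * cis \<theta>" "b = of_real (r * s) * cis \<theta>"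
    have "4 * (t - s)\<^sup>2 * G\<^sup>2 * A\<^sup>2 \<le> T\<^sup>2 * P G t * P G s"
      unfolding defs P_def using sub by (intro same_ray_bound)
    then have "4 * (t - s)\<^sup>2 * A\<^sup>2 * G\<^sup>2 \<le> T\<^sup>2 * P G t * P G s"
      by (simp add: mult_ac)
    moreover have "(cmod (a - b))\<^sup>2 = r\<^sup>2 * (t - s)\<^sup>2"
      unfolding ab d by simp
    ultimately show ?thesis
      using nz(2) nw(2) unfolding ab[symmetric] by (intro combine)
  next
    assume ab: "a = of_real (r * t) * cis 0" "b = of_real (r * s) * cis \<theta>"
    have "4 * ((t - s)\<^sup>2 + 4 * t * s * T\<^sup>2) * A\<^sup>2 * G\<^sup>2 \<le> T\<^sup>2 * P A t * P G s"
      unfolding defs P_def using sub t s by (intro opposite_rays_bound)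
    moreover have "(cmod (a - b))\<^sup>2 = r\<^sup>2 * ((t - s)\<^sup>2 + 4 * t * s * T\<^sup>2)"
      unfolding ab d by (simp add: defs)
    ultimately show ?thesis
      using nz(1) nw(2) unfolding ab[symmetric] by (intro combine)
  next
    assume ab: "a = of_real (r * t) * cis \<theta>" "b = of_real (r * s) * cis 0"
    have "4 * ((t - s)\<^sup>2 + 4 * t * s * T\<^sup>2) * G\<^sup>2 * A\<^sup>2 \<le> T\<^sup>2 * P G t * P A s"
      unfolding defs P_def using sub t s by (intro opposite_rays_bound)
    then have "4 * ((t - s)\<^sup>2 + 4 * t * s * T\<^sup>2) * A\<^sup>2 * G\<^sup>2 \<le> T\<^sup>2 * P G t * P A s"
      by (simp add: mult_ac)
    moreover have "(cmod (a - b))\<^sup>2 = r\<^sup>2 * ((t - s)\<^sup>2 + 4 * t * s * T\<^sup>2)"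
      unfolding ab d by (simp add: defs)
    ultimately show ?thesis
      using nz(2) nw(1) unfolding ab[symmetric] by (intro combine)
  qed
qed

section \<open>Cross-ratios and the supremum\<close>

lemma sqrt_one_plus_square_neq_0: "sqrt (1 + (cmod u)\<^sup>2) \<noteq> 0"
  by (simp add: add_nonneg_eq_0_iff)

text \<open>Each point occurs once above and once below the fraction bar, so the chordal weights
  cancel. If a = x or b = y, both sides are 0 by division by zero.\<close>

lemma cross_ratio_Some:
  "cross_ratio (Some a) (Some x) (Some b) (Some y) = (cmod (a - b) * cmod (x - y)) / (cmod (a - x) * cmod (b - y))"
  using sqrt_one_plus_square_neq_0[of a] sqrt_one_plus_square_neq_0[of b]
    sqrt_one_plus_square_neq_0[of x] sqrt_one_plus_square_neq_0[of y]
  by (simp add: cross_ratio_def divide_simps)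

lemma cross_ratio_None:
  "cross_ratio None (Some x) (Some b) (Some y) = cmod (x - y) / cmod (b - y)"
  "cross_ratio (Some a) (Some x) None (Some y) = cmod (x - y) / cmod (a - x)"
  "cross_ratio None (Some x) None (Some y) = 0"
  using sqrt_one_plus_square_neq_0[of a] sqrt_one_plus_square_neq_0[of b]
    sqrt_one_plus_square_neq_0[of x] sqrt_one_plus_square_neq_0[of y]
  by (simp_all add: cross_ratio_def divide_simps)

theorem theorem4p6:
  fixes \<theta> r :: real and x y :: complex
  assumes "0 < \<theta>" and "\<theta> < pi"
    and "x \<in> sector \<theta>" and "y \<in> sector \<theta>"
    and "Arg2pi x \<le> Arg2pi y"
    and "cmod x = r" and "cmod y = r" and "r > 0"
  defines "a\<^sub>0 \<equiv> Some (complex_of_real r)"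
    and "b\<^sub>0 \<equiv> Some (complex_of_real r * exp (complex_of_real \<theta> * \<i>))"
  shows "a\<^sub>0 \<in> sector_boundary \<theta> \<and> b\<^sub>0 \<in> sector_boundary \<theta> \<and>
    bdd_above ((\<lambda>(a, b). cross_ratio a (Some x) b (Some y))
      ` (sector_boundary \<theta> \<times> sector_boundary \<theta>)) \<and>
    (SUP (a, b) \<in> sector_boundary \<theta> \<times> sector_boundary \<theta>.
       cross_ratio a (Some x) b (Some y)) = cross_ratio a\<^sub>0 (Some x) b\<^sub>0 (Some y)"
proof -
  define \<alpha> \<beta> where "\<alpha> = Arg2pi x" and "\<beta> = Arg2pi y"
  define A G T where defs: "A = sin (\<alpha> / 2)" "G = sin ((\<theta> - \<beta>) / 2)" "T = sin (\<theta> / 2)"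
  have ang: "0 < \<alpha>" "\<alpha> \<le> \<beta>" "\<beta> < \<theta>"
    using assms by (auto simp: \<alpha>_def \<beta>_def sector_def)
  have x: "x = of_real r * cis \<alpha>" and y: "y = of_real r * cis \<beta>"
    using polar_Arg2pi[of x] polar_Arg2pi[of y] assms by (auto simp: \<alpha>_def \<beta>_def)
  have pos: "0 < A" "0 < G" "0 < T"
    unfolding defs using ang assms by (auto intro!: sin_gt_zero)
  have b0: "b\<^sub>0 = Some (of_real r * cis \<theta>)"
    by (simp add: b\<^sub>0_def cis_conv_exp mult.commute)
  have bd: "a\<^sub>0 \<in> sector_boundary \<theta>" "b\<^sub>0 \<in> sector_boundary \<theta>"
    unfolding a\<^sub>0_def b0 sector_boundary_Some frontier_sector[OF assms(1,2)] using assms by auto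
  define K where "K = 2 * r * A * G"
  have K: "0 < K"
    using pos assms by (simp add: K_def)
  \<comment> \<open>The value at \<open>a\<^sub>0\<close>, \<open>b\<^sub>0\<close>, as
    \<open>val\<close> shows, and the upper bound for all other pairs.\<close>
  define M where "M = T * cmod (x - y) / K"
  have M: "0 \<le> M"
    using pos K by (simp add: M_def)
  have chord: "cmod (of_real r * cis \<phi> - of_real r * cis \<psi>) = 2 * r * \<bar>sin ((\<phi> - \<psi>) / 2)\<bar>" for \<phi> \<psi>
  proof -
    have "(cmod (of_real r * cis \<phi> - of_real r * cis \<psi>))\<^sup>2 = (2 * r * \<bar>sin ((\<phi> - \<psi>) / 2)\<bar>)\<^sup>2"
      unfolding norm_polar_diff_sq by (simp add: power_mult_distrib power2_eq_square)
    then show ?thesis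
      using assms by (simp add: power2_eq_iff_nonneg)
  qed
  have "cmod (of_real r - of_real r * cis \<theta>) = 2 * r * T" "cmod (of_real r - x) = 2 * r * A"
    "cmod (of_real r * cis \<theta> - y) = 2 * r * G"
    using pos chord[of 0 \<theta>] chord[of 0 \<alpha>] chord[of \<theta> \<beta>] by (simp_all add: x y defs)
  then have val: "cross_ratio a\<^sub>0 (Some x) b\<^sub>0 (Some y) = M"
    unfolding a\<^sub>0_def b0 cross_ratio_Some M_def K_def using assms by simp
  note bound = sector_frontier_product_bound[OF \<open>r > 0\<close> ang \<open>\<theta> < pi\<close>, folded defs, folded K_def]
  have le: "cross_ratio a (Some x) b (Some y) \<le> M"
    if "a \<in> sector_boundary \<theta>" "b \<in> sector_boundary \<theta>" for a b
  proof -
    \<comment> \<open>Here \<open>p\<close> stands for |a - b| and \<open>q\<close> for |a - x| |b -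
      y|; with one point at infinity \<open>p\<close> is 1 and \<open>q\<close> the remaining
      distance. For q = 0 the quotient is 0, which \<open>M\<close> dominates.\<close>
    have quot: "p * cmod (x - y) / q \<le> M" if "p * K \<le> T * q" "0 \<le> q" for p q
    proof (cases "q = 0")
      case False
      then have "p / q \<le> T / K"
        using that K by (simp add: divide_simps mult.commute)
      then have "p / q * cmod (x - y) \<le> T / K * cmod (x - y)"
        by (rule mult_right_mono) simp
      then show ?thesis
        by (simp add: M_def)
    qed (use M in simp)
    show ?thesis
    proof (cases a; cases b)
      fix u v assume "a = Some u" "b = Some v"
      then show ?thesis
        using that ang bound(1)[OF x _ _ y, of u v]
        by (auto simp: cross_ratio_Some sector_boundary_Some intro!: quot)
    next
      fix v assume "a = None" "b = Some v"
      then show ?thesis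
        \<comment> \<open>With \<open>a\<close> at infinity only |b - y| remains, so the one-point
          bound is applied to \<open>v\<close> and \<open>y\<close>.\<close>
        using that ang bound(2)[OF y _ _ y, of v v] quot[of 1 "cmod (v - y)"]
        by (auto simp: cross_ratio_None sector_boundary_Some)
    next
      fix u assume "a = Some u" "b = None"
      then show ?thesis
        using that ang bound(2)[OF x _ _ x, of u u] quot[of 1 "cmod (u - x)"]
        by (auto simp: cross_ratio_None sector_boundary_Some)
    qed (use M in \<open>simp add: cross_ratio_None\<close>)
  qed
  have "bdd_above ((\<lambda>(a, b). cross_ratio a (Some x) b (Some y)) ` (sector_boundary \<theta> \<times> sector_boundary \<theta>))"
    using le by (intro bdd_aboveI[of _ M]) auto
  \<comment> \<open>The bound \<open>M\<close> is attained at \<open>a\<^sub>0\<close>,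
    \<open>b\<^sub>0\<close>, so the supremum is a maximum.\<close>
  moreover have "(SUP (a, b) \<in> sector_boundary \<theta> \<times> sector_boundary \<theta>. cross_ratio a (Some x) b (Some y)) = M"
    using le bd val by (intro cSup_eq_maximum) (force, auto)
  ultimately show ?thesis
    using bd val by simp
qed

end
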